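(* Assume $\mathcal{D}\cap\mathcal{T}=\emptyset$, $\mathcal{D}\cap\mathcal{B}=\emptyset$ and $\mathcal{T}\cap\mathcal{C}=\emptyset$, and let $\mathcal{Z}^\circ(\mathcal{B})$ and $\mathcal{S}^\circ(\mathcal{C})$ be computed from the initializations $\mathcal{Z}_0=\mathcal{V}\setminus\mathcal{T}$ and $\mathcal{S}_0=\mathcal{D}$. Let $\mathcal{P}$ be the union of all $\mathcal{D}$-to-$\mathcal{T}$ paths. Then: (a) if $\mathcal{B},\mathcal{C}$ are a feasible solution of Problem 2C, then $\mathcal{B}\supseteq\partial_+(\mathcal{Z}^\circ(\mathcal{B}),A)$ and $\mathcal{C}\supseteq\partial_-(\mathcal{S}^\circ(\mathcal{C}),A)$; (b) if $\mathcal{B},\mathcal{C}$ are an optimal solution of Problem 2C, then $\mathcal{B}=\partial_+(\mathcal{Z}^\circ(\mathcal{B}),A)\cap\mathcal{P}=\partial_+(\mathcal{Z}^\circ(\mathcal{B}),A)$ and $\mathcal{C}=\partial_-(\mathcal{S}^\circ(\mathcal{C}),A)\cap\mathcal{P}=\partial_-(\mathcal{S}^\circ(\mathcal{C}),A)$; (c) $\mathcal{B},\mathcal{C}$ are an optimal solution of Problem 2C if and only if they are the minimal cardinality sets of nodes for which $\mathcal{B}=\partial_+(\mathcal{Z}^\circ(\mathcal{B}),A)\cap\mathcal{P}=\partial_+(\mathcal{Z}^\circ(\mathcal{B}),A)$ and $\mathcal{C}=\partial_-(\mathcal{S}^\circ(\mathcal{C}),A)\cap\mathcal{P}=\partial_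-(\mathcal{S}^\circ(\mathcal{C}),A)$.
   Context: Let $(\mathcal{V},\mathcal{E},A)$ be a digraph with $\mathcal{V}=\{v_1,\dots,v_n\}$, where $(v_i,v_j)\in\mathcal{E}$ means $v_i\to v_j$, and $A\in\mathbb{R}^{n\times n}$ has $A_{ji}\ne0$ if and only if $(v_i,v_j)\in\mathcal{E}$. $\mathcal{D},\mathcal{T}\subset\mathcal{V}$ are given sets of disturbance and target nodes; $\mathcal{B},\mathcal{C}\subseteq\mathcal{V}$ are the sets of input and output nodes, to be chosen. $\mathcal{Z}^\circ(\mathcal{B})$ is the (stationary) limit of the recursion $\mathcal{Z}_0=\mathcal{V}\setminus\mathcal{T}$, $\mathcal{Z}_{k+1}=\mathcal{Z}_k\setminus\{v_i\in\mathcal{Z}_k:\exists\,(v_i,v_j)\in\mathcal{E}\text{ with }v_j\notin\mathcal{Z}_k\cup\mathcal{B}\}$; it is the maximal controlled invariant set of nodes contained in $\mathcal{V}\setminus\mathcal{T}$, i.e. the maximal subset $\mathcal{Z}$ of $\mathcal{V}\setminus\mathcal{T}$ such that every edge starting in $\mathcal{Z}$ ends in $\mathcal{Z}\cup\mathcal{B}$. $\mathcal{S}^\circ(\mathcal{C})$ is the (stationary) limit of the recursion $\mathcal{S}_0=\mathcal{D}$, $\mathcal{S}_{k+1}=\mathcal{S}_k\cup\{v_j\notin\mathcal{S}_k:\exists\,(v_i,v_j)\in\mathcal{E}\text{ with }v_i\in\mathcal{S}_k\setminus\mathcal{C}\}$; it is the minimal conditioned invariant set of nodes containing $\mathcal{D}$,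 i.e. the minimal superset $\mathcal{S}$ of $\mathcal{D}$ such that every edge starting in $\mathcal{S}\setminus\mathcal{C}$ ends in $\mathcal{S}$. Problem 2C (minimal input and output cardinality disturbance decoupling by dynamical feedback): minimize $|\mathcal{B}|+|\mathcal{C}|$ over $\mathcal{B},\mathcal{C}$ subject to $\mathcal{S}^\circ(\mathcal{C})\subseteq\mathcal{Z}^\circ(\mathcal{B})$. A pair $\mathcal{B},\mathcal{C}$ is called feasible for Problem 2C if it satisfies this inclusion but is not necessarily of minimal cardinality; an optimal solution is a minimizer. In-boundary of $\mathcal{W}\subseteq\mathcal{V}$: $\partial_-(\mathcal{W},A)=\{v_i\in\mathcal{W}:\exists\,(v_i,v_j)\in\mathcal{E},\ v_j\in\mathcal{V}\setminus\mathcal{W}\}$. Out-boundary: $\partial_+(\mathcal{W},A)=\{v_j\in\mathcal{V}\setminus\mathcal{W}:\exists\,(v_i,v_j)\in\mathcal{E},\ v_i\in\mathcal{W}\}$. A $\mathcal{D}$-to-$\mathcal{T}$ path is a sequence of distinct nodes, the first in $\mathcal{D}$ and the last in $\mathcal{T}$, in which each consecutive pair is an edge; a path is identified with its set of nodes.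
   Formalization: In (c), minimal cardinality is taken among feasible pairs of Problem 2C satisfying the boundary equations; without feasibility the pair of empty sets always satisfies the equations, so (c) would be false whenever a D-to-T path exists. *)

theory Defs
  imports "HOL-Analysis.Analysis"
begin

text \<open>The nodes \<open>v\<^sub>1, \<dots>, v\<^sub>n\<close> are the elements of a finite type \<open>'n\<close>, so that the node set
  is \<^term>\<open>UNIV\<close>. Note the transposition: the entry in row \<open>j\<close> and column \<open>i\<close> gives the edge from
  \<open>i\<close> to \<open>j\<close>.\<close>

definition edges :: "real^'n^'n \<Rightarrow> ('n::finite \<times> 'n) set" where
  "edges A = {(i, j). A $ j $ i \<noteq> 0}"

definition in_boundary :: "'n set \<Rightarrow> real^'n^'n \<Rightarrow> ('n::finite) set" where
  "in_boundary W A = {i \<in> W. \<exists>j. (i, j) \<in> edges A \<and> j \<in> UNIV - W}"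

definition out_boundary :: "'n set \<Rightarrow> real^'n^'n \<Rightarrow> ('n::finite) set" where
  "out_boundary W A = {j \<in> UNIV - W. \<exists>i. (i, j) \<in> edges A \<and> i \<in> W}"

primrec Z_seq :: "real^'n^'n \<Rightarrow> 'n set \<Rightarrow> 'n set \<Rightarrow> nat \<Rightarrow> ('n::finite) set" where
  "Z_seq A T B 0 = UNIV - T"
| "Z_seq A T B (Suc k) =
     Z_seq A T B k - {i \<in> Z_seq A T B k. \<exists>j. (i, j) \<in> edges A \<and> j \<notin> Z_seq A T B k \<union> B}"

primrec S_seq :: "real^'n^'n \<Rightarrow> 'n set \<Rightarrow> 'n set \<Rightarrow> nat \<Rightarrow> ('n::finite) set" where
  "S_seq A D C 0 = D"
| "S_seq A D C (Suc k) =
     S_seq A D C k \<union> {j. j \<notin> S_seq A D C k \<and> (\<exists>i. (i, j) \<in> edges A \<and> i \<in> S_seq A D C k - C)}"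

definition stationary_limit :: "(nat \<Rightarrow> 'a set) \<Rightarrow> 'a set" where
  "stationary_limit X = (THE L. \<exists>K. \<forall>k\<ge>K. X k = L)"

definition Z_max :: "real^'n^'n \<Rightarrow> 'n set \<Rightarrow> 'n set \<Rightarrow> ('n::finite) set" where
  "Z_max A T B = stationary_limit (Z_seq A T B)"

definition S_min :: "real^'n^'n \<Rightarrow> 'n set \<Rightarrow> 'n set \<Rightarrow> ('n::finite) set" where
  "S_min A D C = stationary_limit (S_seq A D C)"

definition feasible_2C :: "real^'n^'n \<Rightarrow> 'n set \<Rightarrow> 'n set \<Rightarrow> 'n set \<Rightarrow> ('n::finite) set \<Rightarrow> bool" where
  "feasible_2C A D T B C \<longleftrightarrow> S_min A D C \<subseteq> Z_max A T B"

definition optimal_2C :: "real^'n^'n \<Rightarrow> 'n set \<Rightarrow> 'n set \<Rightarrow> 'n set \<Rightarrow> ('n::finite) set \<Rightarrow> bool" where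
  "optimal_2C A D T B C \<longleftrightarrow>
     is_arg_min (\<lambda>(B, C). card B + card C) (\<lambda>(B, C). feasible_2C A D T B C) (B, C)"

definition is_path :: "real^'n^'n \<Rightarrow> 'n set \<Rightarrow> 'n set \<Rightarrow> ('n::finite) list \<Rightarrow> bool" where
  "is_path A D T p \<longleftrightarrow> p \<noteq> [] \<and> distinct p \<and> hd p \<in> D \<and> last p \<in> T
     \<and> successively (\<lambda>i j. (i, j) \<in> edges A) p"

definition path_nodes :: "real^'n^'n \<Rightarrow> 'n set \<Rightarrow> 'n set \<Rightarrow> ('n::finite) set" where
  "path_nodes A D T = \<Union> {set p | p. is_path A D T p}"

definition boundary_eqs :: "real^'n^'n \<Rightarrow> 'n set \<Rightarrow> 'n set \<Rightarrow> 'n set \<Rightarrow> ('n::finite) set \<Rightarrow> bool" where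
  "boundary_eqs A D T B C \<longleftrightarrow>
     B = out_boundary (Z_max A T B) A \<inter> path_nodes A D T \<and>
     out_boundary (Z_max A T B) A \<inter> path_nodes A D T = out_boundary (Z_max A T B) A \<and>
     C = in_boundary (S_min A D C) A \<inter> path_nodes A D T \<and>
     in_boundary (S_min A D C) A \<inter> path_nodes A D T = in_boundary (S_min A D C) A"

text \<open>The two recursions do become stationary, so the definite description is well defined,
  and their limits have the extremality properties that give them their names.\<close>

lemma stationary_limit_eqI: "\<forall>k\<ge>K. X k = L \<Longrightarrow> stationary_limit X = L"
  unfolding stationary_limit_def by (rule the_equality) (blast, metis nle_le)

lemma mono_stationary:
  fixes X :: "nat \<Rightarrow> ('a::finite) set"
  assumes "mono X"
  shows "\<exists>K. \<forall>k\<ge>K. X k = \<Union> (range X)"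
proof -
  have "finite (range X)" by simp
  then obtain K where K: "X K = \<Union> (range X)"
  proof -
    obtain F :: "'a \<Rightarrow> nat" where F: "\<And>x. x \<in> \<Union> (range X) \<Longrightarrow> x \<in> X (F x)"
      by (metis UN_E)
    have "x \<in> X (Max (range F))" if "x \<in> \<Union> (range X)" for x
      using F[OF that] monoD[OF assms, of "F x" "Max (range F)"] by auto
    then have "X (Max (range F)) = \<Union> (range X)" by auto
    then show thesis by (rule that)
  qed
  then show ?thesis using monoD[OF assms] by blast
qed

lemma Z_seq_stationary: "\<exists>K. \<forall>k\<ge>K. Z_seq A T B k = Z_max A T B"
proof -
  have "mono (\<lambda>k. - Z_seq A T B k)" unfolding mono_iff_le_Suc by auto
  from mono_stationary[OF this] obtain K
    where K: "\<forall>k\<ge>K. Z_seq A T B k = - (\<Union>k. - Z_seq A T B k)" by (metis double_complement)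
  then show ?thesis unfolding Z_max_def using stationary_limit_eqI by metis
qed

lemma S_seq_stationary: "\<exists>K. \<forall>k\<ge>K. S_seq A D C k = S_min A D C"
proof -
  have "mono (S_seq A D C)" unfolding mono_iff_le_Suc by auto
  from mono_stationary[OF this] show ?thesis
    unfolding S_min_def using stationary_limit_eqI by metis
qed

lemma Z_max_greatest:
  "Z_max A T B =
     (GREATEST Z. Z \<subseteq> UNIV - T \<and> (\<forall>i j. (i, j) \<in> edges A \<and> i \<in> Z \<longrightarrow> j \<in> Z \<union> B))"
proof (rule Greatest_equality[symmetric])
  obtain K where K: "\<forall>k\<ge>K. Z_seq A T B k = Z_max A T B" using Z_seq_stationary by blast
  have sub: "Z_seq A T B k \<subseteq> UNIV - T" for k by (induction k) auto
  have "Z_seq A T B (Suc K) = Z_seq A T B K" using K by (metis le_SucI order_refl)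
  then show "Z_max A T B \<subseteq> UNIV - T \<and>
      (\<forall>i j. (i, j) \<in> edges A \<and> i \<in> Z_max A T B \<longrightarrow> j \<in> Z_max A T B \<union> B)"
    using sub[of K] K by auto
next
  fix Y assume Y: "Y \<subseteq> UNIV - T \<and> (\<forall>i j. (i, j) \<in> edges A \<and> i \<in> Y \<longrightarrow> j \<in> Y \<union> B)"
  have "Y \<subseteq> Z_seq A T B k" for k using Y by (induction k) (simp, auto)
  then show "Y \<subseteq> Z_max A T B" using Z_seq_stationary by (metis order_refl)
qed

lemma S_min_least:
  "S_min A D C =
     (LEAST S. D \<subseteq> S \<and> (\<forall>i j. (i, j) \<in> edges A \<and> i \<in> S - C \<longrightarrow> j \<in> S))"
proof (rule Least_equality[symmetric])
  obtain K where K: "\<forall>k\<ge>K. S_seq A D C k = S_min A D C" using S_seq_stationary by blast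
  have sub: "D \<subseteq> S_seq A D C k" for k by (induction k) auto
  have "S_seq A D C (Suc K) = S_seq A D C K" using K by (metis le_SucI order_refl)
  then show "D \<subseteq> S_min A D C \<and>
      (\<forall>i j. (i, j) \<in> edges A \<and> i \<in> S_min A D C - C \<longrightarrow> j \<in> S_min A D C)"
    using sub[of K] K by auto
next
  fix Y assume Y: "D \<subseteq> Y \<and> (\<forall>i j. (i, j) \<in> edges A \<and> i \<in> Y - C \<longrightarrow> j \<in> Y)"
  have "S_seq A D C k \<subseteq> Y" for k using Y by (induction k) (simp, auto)
  then show "S_min A D C \<subseteq> Y" using S_seq_stationary by (metis order_refl)
qed

text \<open>The empty pair solves the boundary equations for every digraph, feasible or not. Minimal
  cardinality subject to these equations is therefore only meaningful among feasible pairs.\<close>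

lemma boundary_eqs_empty: "boundary_eqs A D T {} {}"
proof -
  obtain K L where KL: "\<forall>k\<ge>K. Z_seq A T {} k = Z_max A T {}" "\<forall>k\<ge>L. S_seq A D {} k = S_min A D {}"
    using Z_seq_stationary S_seq_stationary by metis
  then have "Z_seq A T {} (Suc K) = Z_seq A T {} K" "S_seq A D {} (Suc L) = S_seq A D {} L"
    by (metis le_SucI order_refl)+
  then have "out_boundary (Z_max A T {}) A = {}" "in_boundary (S_min A D {}) A = {}"
    using KL by (auto simp: out_boundary_def in_boundary_def)
  then show ?thesis by (simp add: boundary_eqs_def)
qed

end

theory Submission
  imports Defs
begin

text \<open>
  Write \<open>Z\<close> for \<^term>\<open>Z_max A T B\<close> and \<open>S\<close> for \<^term>\<open>S_min A D C\<close>. Inclusion of the boundaries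
  of \<open>Z\<close> and \<open>S\<close> in \<open>B\<close> and \<open>C\<close> is the invariance of \<open>Z\<close> and \<open>S\<close> itself.

  The equalities at an optimum come from one exchange argument. Let \<open>R\<close> be the set of nodes that
  can be reached from \<open>D\<close> by walks staying inside \<open>Z\<close>. An edge that leaves \<open>R\<close> must leave \<open>Z\<close> as
  well, so \<open>out_boundary R A \<subseteq> out_boundary Z A \<subseteq> B\<close>. On the other hand, feasibility forces
  \<open>S \<subseteq> R\<close>, and \<open>R\<close> is controlled invariant for the inputs \<open>out_boundary R A\<close>; hence these inputs
  together with \<open>C\<close> are again feasible (lemma \<open>feasible_reachable_boundary\<close>). If \<open>(B, C)\<close> is
  optimal, nothing can be saved, and all three sets coincide.

  The set \<open>R\<close> also provides the paths. An input node \<open>b\<close> has a predecessor in \<open>R\<close>, which a simple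
  path inside \<open>Z\<close> joins to \<open>D\<close>; and, like every node outside \<open>Z\<close>, it is joined to \<open>T\<close> by a simple
  path that stays outside \<open>Z\<close> (lemma \<open>reaches_target_outside_Z_max\<close>). The two halves are disjoint
  because \<open>Z\<close> separates them, so their concatenation is a simple path through \<open>b\<close>. Joining
  arbitrary walks would not do: removing their cycles could remove \<open>b\<close>.

  The claims about outputs follow by reversing all edges, that is, transposing \<open>A\<close>: this exchanges
  \<open>D\<close> with \<open>T\<close>, \<open>B\<close> with \<open>C\<close>, and \<open>S\<close> with the complement of \<open>Z\<close>.

  Finally, a cardinality minimum over the feasible pairs is attained as soon as there is a feasible
  pair, and it is attained only at pairs satisfying the boundary equations. Restricting the
  minimization to pairs that satisfy them therefore changes neither the minimum nor the minimizers.
\<close>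

section \<open>Extremality of the two limits\<close>

lemma Z_max_disjoint: "Z_max A T B \<inter> T = {}"
proof -
  have "Z_seq A T B k \<subseteq> UNIV - T" for k by (induction k) auto
  then show ?thesis using Z_seq_stationary[of A T B] by blast
qed

lemma Z_max_invariant:
  assumes "(i, j) \<in> edges A" "i \<in> Z_max A T B"
  shows "j \<in> Z_max A T B \<union> B"
proof -
  obtain K where K: "\<forall>k\<ge>K. Z_seq A T B k = Z_max A T B" using Z_seq_stationary by blast
  then have "Z_seq A T B (Suc K) = Z_seq A T B K" by (metis le_SucI order_refl)
  then show ?thesis using K assms by auto
qed

lemma Z_max_maximal:
  assumes "Y \<inter> T = {}" "\<And>i j. (i, j) \<in> edges A \<Longrightarrow> i \<in> Y \<Longrightarrow> j \<in> Y \<union> B"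
  shows "Y \<subseteq> Z_max A T B"
proof -
  have "Y \<subseteq> Z_seq A T B k" for k using assms by (induction k) (simp, blast, auto)
  then show ?thesis using Z_seq_stationary by (metis order_refl)
qed

lemma out_boundary_Z_max_subset: "out_boundary (Z_max A T B) A \<subseteq> B"
  using Z_max_invariant[of _ _ A T B] by (auto simp: out_boundary_def)

section \<open>Edge reversal\<close>

lemma edges_transpose: "edges (transpose A) = (edges A)\<inverse>"
  by (auto simp: edges_def transpose_def)

lemma S_seq_eq_compl: "S_seq A D C k = - Z_seq (transpose A) D C k"
  by (induction k) (auto simp: edges_transpose)

lemma S_min_eq_compl: "S_min A D C = - Z_max (transpose A) D C"
proof -
  obtain K where "\<forall>k\<ge>K. Z_seq (transpose A) D C k = Z_max (transpose A) D C"
    using Z_seq_stationary by blast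
  then show ?thesis
    unfolding S_min_def by (intro stationary_limit_eqI[of K]) (simp add: S_seq_eq_compl)
qed

lemma in_boundary_eq_out_boundary: "in_boundary W A = out_boundary (- W) (transpose A)"
  by (auto simp: in_boundary_def out_boundary_def edges_transpose)

lemma feasible_2C_transpose:
  "feasible_2C (transpose A) T D C B \<longleftrightarrow> feasible_2C A D T B C"
  by (auto simp: feasible_2C_def S_min_eq_compl)

lemma optimal_2C_transpose:
  "optimal_2C (transpose A) T D C B \<longleftrightarrow> optimal_2C A D T B C"
  by (simp add: optimal_2C_def is_arg_min_def feasible_2C_transpose) (metis add.commute)

lemma is_path_transpose: "is_path (transpose A) T D (rev p) \<longleftrightarrow> is_path A D T p"
  by (auto simp: is_path_def edges_transpose hd_rev last_rev)

lemma path_nodes_transpose: "path_nodes (transpose A) T D = path_nodes A D T"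
proof -
  have "path_nodes A D T \<subseteq> path_nodes (transpose A) T D" for A :: "real^'n^'n" and D T
    unfolding path_nodes_def using is_path_transpose[of A T D] by (fastforce intro: set_rev[symmetric])
  from this[of A D T] this[of "transpose A" T D] show ?thesis by auto
qed

lemma S_min_invariant:
  assumes "(i, j) \<in> edges A" "i \<in> S_min A D C - C"
  shows "j \<in> S_min A D C"
  using assms Z_max_invariant[of j i "transpose A" D C]
  by (auto simp: S_min_eq_compl edges_transpose)

lemma S_min_minimal:
  assumes "D \<subseteq> Y" "\<And>i j. (i, j) \<in> edges A \<Longrightarrow> i \<in> Y - C \<Longrightarrow> j \<in> Y"
  shows "S_min A D C \<subseteq> Y"
proof -
  have "- Y \<subseteq> Z_max (transpose A) D C"
    using assms by (intro Z_max_maximal) (auto simp: edges_transpose)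
  then show ?thesis by (auto simp: S_min_eq_compl)
qed

lemma subset_S_min: "D \<subseteq> S_min A D C"
  using Z_max_disjoint[of "transpose A" D C] by (auto simp: S_min_eq_compl)

section \<open>Walks inside and outside the controlled invariant set\<close>

lemma rtrancl_within_imp_simple_path:
  assumes "(x, y) \<in> (r \<inter> W \<times> W)\<^sup>*" "x \<in> W"
  shows "\<exists>p. p \<noteq> [] \<and> distinct p \<and> hd p = x \<and> last p = y \<and> set p \<subseteq> W \<and>
           successively (\<lambda>i j. (i, j) \<in> r) p"
  using assms(1)
proof (induction rule: rtrancl_induct)
  case base
  show ?case using assms(2) by (intro exI[of _ "[x]"]) auto
next
  case (step y z)
  then obtain p where p: "p \<noteq> []" "distinct p" "hd p = x" "last p = y" "set p \<subseteq> W"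
    "successively (\<lambda>i j. (i, j) \<in> r) p" by blast
  show ?case
  proof (cases "z \<in> set p")
    case True
    then obtain q s where "p = (q @ [z]) @ s" by (auto dest: split_list)
    then show ?thesis
      using p by (intro exI[of _ "q @ [z]"]) (auto simp: successively_append_iff hd_append)
  next
    case False
    then show ?thesis
      using p step.hyps by (intro exI[of _ "p @ [z]"]) (auto simp: successively_append_iff)
  qed
qed

text \<open>The nodes outside \<open>Z\<close> from which \<open>T\<close> cannot be reached outside \<open>Z\<close> could be added to \<open>Z\<close>
  without violating controlled invariance. By maximality there are none.\<close>

lemma reaches_target_outside_Z_max:
  fixes A :: "real^'n::finite^'n" and T B :: "'n set"
  defines "U \<equiv> - Z_max A T B"
  assumes "i \<in> U"
  shows "\<exists>t\<in>T. (i, t) \<in> (edges A \<inter> U \<times> U)\<^sup>*"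
proof (rule ccontr)
  assume no: "\<not> ?thesis"
  define N where "N = {i \<in> U. \<not> (\<exists>t\<in>T. (i, t) \<in> (edges A \<inter> U \<times> U)\<^sup>*)}"
  have "Z_max A T B \<union> N \<subseteq> Z_max A T B"
  proof (rule Z_max_maximal)
    show "(Z_max A T B \<union> N) \<inter> T = {}"
      using Z_max_disjoint[of A T B] by (auto simp: N_def)
  next
    fix i j assume ij: "(i, j) \<in> edges A" "i \<in> Z_max A T B \<union> N"
    show "j \<in> (Z_max A T B \<union> N) \<union> B"
    proof (cases "i \<in> Z_max A T B \<or> j \<in> Z_max A T B")
      case True
      then show ?thesis using Z_max_invariant ij(1) by blast
    next
      case False
      then have "(i, j) \<in> edges A \<inter> U \<times> U" using ij by (auto simp: U_def)
      then have "j \<in> N" using ij(2) False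
        by (auto simp: N_def intro: converse_rtrancl_into_rtrancl)
      then show ?thesis by blast
    qed
  qed
  then show False using no assms(2) by (auto simp: N_def U_def)
qed

text \<open>Starting from \<^term>\<open>D \<inter> Z_max A T B\<close> keeps this set inside \<^term>\<open>Z_max A T B\<close> for arbitrary
  \<open>D\<close>; for a feasible pair, \<open>D\<close> already lies in \<^term>\<open>Z_max A T B\<close>.\<close>

definition reachable_in_Z_max :: "real^'n^'n \<Rightarrow> 'n set \<Rightarrow> 'n set \<Rightarrow> 'n set \<Rightarrow> ('n::finite) set" where
  "reachable_in_Z_max A D T B =
     (edges A \<inter> Z_max A T B \<times> Z_max A T B)\<^sup>* `` (D \<inter> Z_max A T B)"

lemma reachable_in_Z_max_subset: "reachable_in_Z_max A D T B \<subseteq> Z_max A T B"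
  by (auto simp: reachable_in_Z_max_def elim: rtranclE)

lemma reachable_in_Z_max_step:
  assumes "(i, j) \<in> edges A" "i \<in> reachable_in_Z_max A D T B" "j \<in> Z_max A T B"
  shows "j \<in> reachable_in_Z_max A D T B"
proof -
  have "i \<in> Z_max A T B" using assms(2) reachable_in_Z_max_subset by blast
  then show ?thesis using assms
    unfolding reachable_in_Z_max_def by (auto intro: rtrancl_into_rtrancl)
qed

lemma out_boundary_reachable_subset:
  "out_boundary (reachable_in_Z_max A D T B) A \<subseteq> out_boundary (Z_max A T B) A"
  using reachable_in_Z_max_step[of _ _ A D T B] reachable_in_Z_max_subset[of A D T B]
  unfolding out_boundary_def by blast

text \<open>The disturbance only ever gets to nodes that it can reach inside \<open>Z\<close>, so it suffices to
  control the edges that leave this smaller set.\<close>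

lemma feasible_reachable_boundary:
  assumes "feasible_2C A D T B C"
  shows "feasible_2C A D T (out_boundary (reachable_in_Z_max A D T B) A) C"
proof -
  define R where "R = reachable_in_Z_max A D T B"
  have SZ: "S_min A D C \<subseteq> Z_max A T B" using assms by (simp add: feasible_2C_def)
  have "D \<subseteq> R" using subset_S_min[of D A C] SZ by (auto simp: R_def reachable_in_Z_max_def)
  \<comment> \<open>\<open>R\<close> itself need not be conditioned invariant, since edges from \<open>R - C\<close> may leave \<open>Z\<close>.
      Those from \<open>S - C\<close> stay in \<open>S\<close>, hence in \<open>Z\<close>.\<close>
  have "S_min A D C \<subseteq> S_min A D C \<inter> R"
  proof (rule S_min_minimal)
    show "D \<subseteq> S_min A D C \<inter> R" using \<open>D \<subseteq> R\<close> subset_S_min by blast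
    show "j \<in> S_min A D C \<inter> R" if "(i, j) \<in> edges A" "i \<in> S_min A D C \<inter> R - C" for i j
    proof -
      have "j \<in> S_min A D C" using that S_min_invariant by blast
      then show ?thesis using that SZ reachable_in_Z_max_step[of i j A D T B] by (auto simp: R_def)
    qed
  qed
  moreover have "R \<subseteq> Z_max A T (out_boundary R A)"
  proof (rule Z_max_maximal)
    show "R \<inter> T = {}"
      using Z_max_disjoint[of A T B] reachable_in_Z_max_subset[of A D T B] by (auto simp: R_def)
  qed (auto simp: out_boundary_def)
  ultimately show ?thesis by (auto simp: feasible_2C_def R_def)
qed

text \<open>The corresponding inclusion for \<^term>\<open>out_boundary (Z_max A T B) A\<close> fails in general: a node
  there may have all its predecessors out of reach of \<open>D\<close>.\<close>

lemma out_boundary_reachable_on_path: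
  "out_boundary (reachable_in_Z_max A D T B) A \<subseteq> path_nodes A D T"
proof
  fix b assume b: "b \<in> out_boundary (reachable_in_Z_max A D T B) A"
  define Z where "Z = Z_max A T B"
  obtain i where i: "(i, b) \<in> edges A" "i \<in> reachable_in_Z_max A D T B"
    using b by (auto simp: out_boundary_def)
  have "b \<in> - Z"
    using b out_boundary_reachable_subset[of A D T B] by (auto simp: out_boundary_def Z_def)
  obtain d where d: "d \<in> D" "d \<in> Z" "(d, i) \<in> (edges A \<inter> Z \<times> Z)\<^sup>*"
    using i(2) by (auto simp: reachable_in_Z_max_def Z_def)
  obtain t where t: "t \<in> T" "(b, t) \<in> (edges A \<inter> (- Z) \<times> (- Z))\<^sup>*"
    using reaches_target_outside_Z_max \<open>b \<in> - Z\<close> unfolding Z_def by blast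
  obtain p where p: "p \<noteq> []" "distinct p" "hd p = d" "last p = i" "set p \<subseteq> Z"
    "successively (\<lambda>i j. (i, j) \<in> edges A) p"
    using rtrancl_within_imp_simple_path[OF d(3,2)] by blast
  obtain q where q: "q \<noteq> []" "distinct q" "hd q = b" "last q = t" "set q \<subseteq> - Z"
    "successively (\<lambda>i j. (i, j) \<in> edges A) q"
    using rtrancl_within_imp_simple_path[OF t(2) \<open>b \<in> - Z\<close>] by blast
  have "is_path A D T (p @ q)"
    using p q d(1) t(1) i(1) by (auto simp: is_path_def successively_append_iff)
  moreover have "b \<in> set (p @ q)" using q(1,3) hd_in_set[of q] by auto
  ultimately show "b \<in> path_nodes A D T" unfolding path_nodes_def by blast
qed

section \<open>Optimal pairs\<close>

lemma optimal_2C_imp_feasible: "optimal_2C A D T B C \<Longrightarrow> feasible_2C A D T B C"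
  by (simp add: optimal_2C_def is_arg_min_def)

lemma optimal_2C_card_le:
  "optimal_2C A D T B C \<Longrightarrow> feasible_2C A D T B' C' \<Longrightarrow> card B + card C \<le> card B' + card C'"
  by (force simp: optimal_2C_def is_arg_min_def not_less)

lemma optimal_inputs:
  assumes "optimal_2C A D T B C"
  shows "B = out_boundary (Z_max A T B) A \<and> B \<subseteq> path_nodes A D T"
proof -
  define R where "R = reachable_in_Z_max A D T B"
  have le: "out_boundary R A \<subseteq> out_boundary (Z_max A T B) A" "out_boundary (Z_max A T B) A \<subseteq> B"
    by (simp_all add: R_def out_boundary_reachable_subset out_boundary_Z_max_subset)
  have "feasible_2C A D T (out_boundary R A) C"
    unfolding R_def using assms by (intro feasible_reachable_boundary optimal_2C_imp_feasible)
  then have "card B \<le> card (out_boundary R A)" using optimal_2C_card_le[OF assms] by force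
  then have "out_boundary R A = B" using le by (intro card_seteq) auto
  then show ?thesis using le out_boundary_reachable_on_path[of A D T B] by (auto simp: R_def)
qed

lemma optimal_outputs:
  assumes "optimal_2C A D T B C"
  shows "C = in_boundary (S_min A D C) A \<and> C \<subseteq> path_nodes A D T"
  using optimal_inputs[of "transpose A" T D C B] assms
  by (simp add: optimal_2C_transpose in_boundary_eq_out_boundary S_min_eq_compl path_nodes_transpose)

lemma optimal_2C_imp_boundary_eqs: "optimal_2C A D T B C \<Longrightarrow> boundary_eqs A D T B C"
  using optimal_inputs[of A D T B C] optimal_outputs[of A D T B C]
  unfolding boundary_eqs_def by blast

lemma is_arg_min_restrict:
  fixes f :: "'a \<Rightarrow> 'b::wellorder"
  assumes "\<And>y. is_arg_min f P y \<Longrightarrow> Q y"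
  shows "is_arg_min f P x \<longleftrightarrow> is_arg_min f (\<lambda>y. P y \<and> Q y) x"
proof
  assume "is_arg_min f P x"
  then show "is_arg_min f (\<lambda>y. P y \<and> Q y) x" using assms by (auto simp: is_arg_min_def)
next
  assume x: "is_arg_min f (\<lambda>y. P y \<and> Q y) x"
  then have "P x" by (simp add: is_arg_min_def)
  then obtain z where z: "P z" "\<And>y. P y \<Longrightarrow> f z \<le> f y"
    using exists_least_iff[of "\<lambda>v. \<exists>y. P y \<and> f y = v"] by (metis not_le)
  then have "is_arg_min f P z" by (auto simp: is_arg_min_def not_less)
  then have "f x \<le> f z" using x z(1) assms by (auto simp: is_arg_min_def not_less)
  then show "is_arg_min f P x" using \<open>P x\<close> z(2) by (force simp: is_arg_min_def not_less)
qed

theorem theorem8: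
  fixes A :: "real^'n^'n"
    and D T B C :: "('n::finite) set"
  assumes "D \<inter> T = {}" and "D \<inter> B = {}" and "T \<inter> C = {}"
  shows "(feasible_2C A D T B C \<longrightarrow>
           B \<supseteq> out_boundary (Z_max A T B) A \<and> C \<supseteq> in_boundary (S_min A D C) A) \<and>
         (optimal_2C A D T B C \<longrightarrow>
           B = out_boundary (Z_max A T B) A \<inter> path_nodes A D T \<and>
           out_boundary (Z_max A T B) A \<inter> path_nodes A D T = out_boundary (Z_max A T B) A \<and>
           C = in_boundary (S_min A D C) A \<inter> path_nodes A D T \<and>
           in_boundary (S_min A D C) A \<inter> path_nodes A D T = in_boundary (S_min A D C) A) \<and>
         (optimal_2C A D T B C \<longleftrightarrow>
           is_arg_min (\<lambda>(B', C'). card B' + card C')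
             (\<lambda>(B', C'). feasible_2C A D T B' C' \<and> boundary_eqs A D T B' C') (B, C))"
proof (intro conjI[OF _ conjI])
  show "feasible_2C A D T B C \<longrightarrow>
      B \<supseteq> out_boundary (Z_max A T B) A \<and> C \<supseteq> in_boundary (S_min A D C) A"
    using out_boundary_Z_max_subset[of A T B] out_boundary_Z_max_subset[of "transpose A" D C]
    by (simp add: in_boundary_eq_out_boundary S_min_eq_compl)
next
  show "optimal_2C A D T B C \<longrightarrow>
      B = out_boundary (Z_max A T B) A \<inter> path_nodes A D T \<and>
      out_boundary (Z_max A T B) A \<inter> path_nodes A D T = out_boundary (Z_max A T B) A \<and>
      C = in_boundary (S_min A D C) A \<inter> path_nodes A D T \<and>
      in_boundary (S_min A D C) A \<inter> path_nodes A D T = in_boundary (S_min A D C) A"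
    using optimal_2C_imp_boundary_eqs[of A D T B C] unfolding boundary_eqs_def by blast
next
  have "optimal_2C A D T B C \<longleftrightarrow> is_arg_min (\<lambda>(B', C'). card B' + card C')
      (\<lambda>x. (case x of (B', C') \<Rightarrow> feasible_2C A D T B' C') \<and>
           (case x of (B', C') \<Rightarrow> boundary_eqs A D T B' C')) (B, C)"
    unfolding optimal_2C_def
  proof (rule is_arg_min_restrict)
    fix y
    assume "is_arg_min (\<lambda>(B', C'). card B' + card C')
      (\<lambda>(B', C'). feasible_2C A D T B' C') y"
    then show "case y of (B', C') \<Rightarrow> boundary_eqs A D T B' C'"
      using optimal_2C_imp_boundary_eqs[of A D T "fst y" "snd y"]
      by (simp add: optimal_2C_def case_prod_beta)
  qed
  then show "optimal_2C A D T B C \<longleftrightarrow>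
      is_arg_min (\<lambda>(B', C'). card B' + card C')
        (\<lambda>(B', C'). feasible_2C A D T B' C' \<and> boundary_eqs A D T B' C') (B, C)"
    by (simp add: case_prod_unfold)
qed

end
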